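(* For every $(u,v)\in\mathbb R^2$, $$\nu(u,v)=\begin{cases} v-\dfrac1{4u},&(u,v)\in\mathcal I_1,\\[2mm] \Psi_2(u,v),&(u,v)\in\mathcal I_2,\\[1mm] u-\dfrac1{4v},&(u,v)\in\mathcal I_3,\\[2mm] \Phi_1(u,v),&(u,v)\in\mathcal E_1,\\[1mm] \Phi_3(u,v),&(u,v)\in\mathcal E_3,\end{cases}$$ where the five regions cover $\mathbb R^2$ and, at a point lying in several regions, each of the corresponding formulas holds. Consequently, an explicit formula for $\|(a,b,c)\|_{\mathfrak O}$ is obtained for every $(a,b,c)\in\mathbb R^3$: for $b\neq0$, $\|(a,b,c)\|_{\mathfrak O}=|b|\,\nu(a/b,c/b)$ with $\nu$ given by the formula above, and for $b=0$, $\|(a,0,c)\|_{\mathfrak O}=\max\{|a|,|c|,|\tau^2a+c|,|a+\tau^2c|\}$.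
   Context: Let $\tau=\sqrt2-1$ and $\mathfrak O=\{(x,y)\in[0,1]^2: x+y\le\sqrt2\}$. A triple $(a,b,c)\in\mathbb R^3$ is identified with the quadratic form $P(x,y)=ax^2+bxy+cy^2$, and $\|(a,b,c)\|_{\mathfrak O}=\sup\{|P(x,y)|:(x,y)\in\mathfrak O\}$. Put $\nu(u,v)=\|(u,1,v)\|_{\mathfrak O}$ for $(u,v)\in\mathbb R^2$. Let $\eta=\frac1{2\tau}=\frac{1+\sqrt2}2$ and $\delta=\frac{1-\tau}2=1-\frac1{\sqrt2}$. Define $$\Phi_1(u,v)=\max\{|v|,|\tau^2u+\tau+v|\},\qquad \Phi_3(u,v)=\max\{|u|,|u+\tau+\tau^2v|\},$$ $$\Psi_2(u,v)=\frac{1-4uv}{2(1-u-v)}\ \text{ if }(u,v)\ne(\tfrac12,\tfrac12),\qquad \Psi_2(\tfrac12,\tfrac12)=1$$ ($\Psi_2$ is used only on $\mathcal I_2$). The regions are the following subsets of $\mathbb R^2$: $$\mathcal I_1=\{(u,v): u\le-\eta,\ v\ge -u+\tfrac1{4u}\},$$ $$\mathcal I_2=\{(u,v): v\le\delta+\tau u,\ u\le\delta+\tau v,\ 2u^2+6uv-2u-1\le0,\ 2v^2+6uv-2v-1\le0\},$$ $$\mathcal I_3=\{(u,v): v\le-\eta,\ u\ge -v+\tfrac1{4v}\},$$ $$\mathcal E_0=\mathbb R^2\setminus(\operatorname{int}\mathcal I_1\cup\operatorname{int}\mathcal I_2\cup\operatorname{int}\mathcal I_3),$$ $$\mathcal E_1=\{(u,v)\in\mathcal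 E_0:\Phi_1(u,v)\ge\Phi_3(u,v)\},\qquad \mathcal E_3=\{(u,v)\in\mathcal E_0:\Phi_3(u,v)\ge\Phi_1(u,v)\}.$$ Here $\operatorname{int}$ denotes the topological interior in $\mathbb R^2$. *)

theory Defs
  imports "HOL-Analysis.Analysis"
begin

definition tau :: real where "tau = sqrt 2 - 1"

definition eta :: real where "eta = 1 / (2 * tau)"

definition delta :: real where "delta = (1 - tau) / 2"

definition Oct :: "(real \<times> real) set" where
  "Oct = {(x, y). x \<in> {0..1} \<and> y \<in> {0..1} \<and> x + y \<le> sqrt 2}"

fun qform :: "real \<times> real \<times> real \<Rightarrow> real \<times> real \<Rightarrow> real" where
  "qform (a, b, c) (x, y) = a * x\<^sup>2 + b * x * y + c * y\<^sup>2"

(* The supremum is over a nonempty set bounded above, as Oct is compact and contains the origin. *)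
definition oct_norm :: "real \<times> real \<times> real \<Rightarrow> real" where
  "oct_norm p = (SUP z \<in> Oct. \<bar>qform p z\<bar>)"

definition nu :: "real \<Rightarrow> real \<Rightarrow> real" where
  "nu u v = oct_norm (u, 1, v)"

definition Phi1 :: "real \<Rightarrow> real \<Rightarrow> real" where
  "Phi1 u v = max \<bar>v\<bar> \<bar>tau\<^sup>2 * u + tau + v\<bar>"

definition Phi3 :: "real \<Rightarrow> real \<Rightarrow> real" where
  "Phi3 u v = max \<bar>u\<bar> \<bar>u + tau + tau\<^sup>2 * v\<bar>"

(* Used only on I2, where u + v = 1 forces u = v = 1/2; elsewhere on the line u + v = 1
   the value is the junk value 0 of division by zero. *)
definition Psi2 :: "real \<Rightarrow> real \<Rightarrow> real" where
  "Psi2 u v = (if (u, v) = (1/2, 1/2) then 1 else (1 - 4 * u * v) / (2 * (1 - u - v)))"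

definition I1 :: "(real \<times> real) set" where
  "I1 = {(u, v). u \<le> - eta \<and> v \<ge> - u + 1 / (4 * u)}"

definition I2 :: "(real \<times> real) set" where
  "I2 = {(u, v). v \<le> delta + tau * u \<and> u \<le> delta + tau * v \<and>
           2 * u\<^sup>2 + 6 * u * v - 2 * u - 1 \<le> 0 \<and> 2 * v\<^sup>2 + 6 * u * v - 2 * v - 1 \<le> 0}"

definition I3 :: "(real \<times> real) set" where
  "I3 = {(u, v). v \<le> - eta \<and> u \<ge> - v + 1 / (4 * v)}"

definition E0 :: "(real \<times> real) set" where
  "E0 = UNIV - (interior I1 \<union> interior I2 \<union> interior I3)"

definition E1 :: "(real \<times> real) set" where
  "E1 = {(u, v). (u, v) \<in> E0 \<and> Phi1 u v \<ge> Phi3 u v}"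

definition E3 :: "(real \<times> real) set" where
  "E3 = {(u, v). (u, v) \<in> E0 \<and> Phi3 u v \<ge> Phi1 u v}"

end

theory Submission
  imports Defs
begin

text \<open>
  By homogeneity, the supremum of \<open>\<bar>P\<bar>\<close> over the octagon is attained on the three edges \<open>x = 1\<close>,
  \<open>y = 1\<close> and \<open>x + y = \<surd>2\<close>, on each of which \<open>P\<close> is a quadratic polynomial in one variable. So it is
  the largest of the absolute values at the vertices \<open>(1, 0)\<close>, \<open>(1, \<tau>)\<close>, \<open>(\<tau>, 1)\<close>, \<open>(0, 1)\<close>
  and at the critical points lying inside the edges. An interior minimum never matters, and an
  interior maximum exceeds the vertex values only in the interior of one of the regions
  \<open>I1\<close>, \<open>I2\<close>, \<open>I3\<close>.
\<close>

section \<open>Arithmetic of the constants \<open>tau\<close>, \<open>eta\<close> and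
  \<open>delta\<close>\<close>

lemma tau_sq: "tau\<^sup>2 = 1 - 2 * tau"
  by (simp add: tau_def power2_diff)

lemma sqrt2_eq: "sqrt 2 = 1 + tau"
  by (simp add: tau_def)

lemma tau_bounds: "2/5 < tau" "tau < 1/2"
proof -
  have "7/5 < sqrt 2" by (rule real_less_rsqrt) (simp add: power2_eq_square)
  moreover have "sqrt 2 < 3/2" by (rule real_less_lsqrt) (simp_all add: power2_eq_square)
  ultimately show "2/5 < tau" "tau < 1/2" by (simp_all add: tau_def)
qed

text \<open>Since \<open>tau * (tau + 2) = 1\<close>, the reciprocal in \<open>eta\<close> becomes
  affine in \<open>tau\<close>, which brings comparisons such as \<open>1 < eta\<close> within reach
  of linear arithmetic.\<close>

lemma eta_eq: "eta = 1 + tau / 2"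
proof -
  have "2 * tau * (1 + tau / 2) = 1"
    using tau_sq by (simp add: algebra_simps power2_eq_square)
  then show ?thesis
    using tau_bounds by (simp add: eta_def field_simps)
qed

lemma delta_eq: "delta = 1 / 2 - tau / 2"
  by (simp add: delta_def field_simps)

section \<open>Reduction to three edges by homogeneity\<close>

text \<open>Each point of the octagon is \<open>r\<close> times a point of one of the three edges,
  with \<open>r\<close> between 0 and 1. The form then scales by \<open>r\<^sup>2 \<le> 1\<close>,
  so bounds on the edges carry over.\<close>

lemma abs_qform_le_if_edges:
  assumes e1: "\<And>y. 0 \<le> y \<Longrightarrow> y \<le> tau \<Longrightarrow> \<bar>qform (a, b, c) (1, y)\<bar> \<le> M"
    and e2: "\<And>x. 0 \<le> x \<Longrightarrow> x \<le> tau \<Longrightarrow> \<bar>qform (a, b, c) (x, 1)\<bar> \<le> M"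
    and e3: "\<And>x. tau \<le> x \<Longrightarrow> x \<le> 1 \<Longrightarrow> \<bar>qform (a, b, c) (x, sqrt 2 - x)\<bar> \<le> M"
    and z: "z \<in> Oct"
  shows "\<bar>qform (a, b, c) z\<bar> \<le> M"
proof -
  obtain x y where z_eq: "z = (x, y)" by (cases z)
  with z have xy: "0 \<le> x" "x \<le> 1" "0 \<le> y" "y \<le> 1" "x + y \<le> sqrt 2"
    by (auto simp: Oct_def)
  note tau = tau_bounds
  have M: "0 \<le> M" using e1[of 0] tau by auto
  have scale: "\<bar>qform (a, b, c) (r * x', r * y')\<bar> \<le> M"
    if "\<bar>qform (a, b, c) (x', y')\<bar> \<le> M" "0 \<le> r" "r \<le> 1" for r x' y'
  proof -
    have "qform (a, b, c) (r * x', r * y') = r\<^sup>2 * qform (a, b, c) (x', y')"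
      by (simp add: algebra_simps power2_eq_square)
    then have "\<bar>qform (a, b, c) (r * x', r * y')\<bar> = r\<^sup>2 * \<bar>qform (a, b, c) (x', y')\<bar>"
      by (simp add: abs_mult)
    also have "\<dots> \<le> 1 * M"
      using that by (intro mult_mono) (auto simp: power_le_one)
    finally show ?thesis by simp
  qed
  have pos: "0 < x" if "y \<le> tau * x" "0 < x + y"
    using that xy by (cases "x = 0") auto
  have pos': "0 < y" if "x \<le> tau * y" "0 < x + y"
    using that xy by (cases "y = 0") auto
  \<comment> \<open>The rays through \<open>(1, tau)\<close> and \<open>(tau, 1)\<close> cut the
    quadrant into three sectors, one for each edge; the origin is handled apart.\<close>
  consider "x = 0" "y = 0" | "0 < x" "y \<le> tau * x" | "0 < y" "x \<le> tau * y"
    | "tau * x < y" "tau * y < x" "0 < x + y"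
  proof (cases "x + y = 0")
    case True
    with xy that(1) show ?thesis by simp
  next
    case False
    with xy have "0 < x + y" by simp
    with pos pos' that(2-4) show ?thesis by (meson not_le)
  qed
  then show ?thesis
  proof cases
    case 1
    with M z_eq show ?thesis by simp
  next
    case 2
    then have "\<bar>qform (a, b, c) (x * 1, x * (y / x))\<bar> \<le> M"
      using xy by (intro scale e1) (auto simp: field_simps)
    with 2 z_eq show ?thesis by simp
  next
    case 3
    then have "\<bar>qform (a, b, c) (y * (x / y), y * 1)\<bar> \<le> M"
      using xy by (intro scale e2) (auto simp: field_simps)
    with 3 z_eq show ?thesis by simp
  next
    case 4
    \<comment> \<open>Dividing by this factor moves the point to the line
      \<open>x + y = sqrt 2\<close>; the sector inequalities then place it between the two
      vertices.\<close>
    define r where "r = (x + y) / sqrt 2"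
    have r: "0 < r" "r \<le> 1" using 4 xy by (auto simp: r_def)
    have sum: "x + y = r * (1 + tau)"
      using tau by (simp add: r_def flip: sqrt2_eq)
    have "(1 + tau) * (tau * r) = tau * (x + y)"
      by (simp add: sum ac_simps)
    then have "(1 + tau) * (tau * r) < (1 + tau) * x" "(1 + tau) * (tau * r) < (1 + tau) * y"
      using 4 by (simp_all add: distrib_left distrib_right)
    then have "tau * r \<le> x" "tau * r \<le> y"
      using tau by simp_all
    then have "tau \<le> x / r" "x / r \<le> 1"
      using r sum by (auto simp: field_simps)
    then have "\<bar>qform (a, b, c) (r * (x / r), r * (sqrt 2 - x / r))\<bar> \<le> M"
      using r by (intro scale e3) auto
    moreover have "r * (sqrt 2 - x / r) = y"
      using r by (simp add: sqrt2_eq right_diff_distrib flip: sum)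
    ultimately show ?thesis using r z_eq by simp
  qed
qed

section \<open>Vertices, boundedness, scaling and symmetry of the norm\<close>

lemma vertices_in_Oct: "(1, 0) \<in> Oct" "(0, 1) \<in> Oct" "(1, tau) \<in> Oct" "(tau, 1) \<in> Oct"
  using tau_bounds by (auto simp: Oct_def sqrt2_eq)

lemma bdd_above_qform: "bdd_above ((\<lambda>z. \<bar>qform p z\<bar>) ` Oct)"
proof -
  obtain a b c where p: "p = (a, b, c)" by (cases p)
  have "\<bar>qform p z\<bar> \<le> \<bar>a\<bar> + \<bar>b\<bar> + \<bar>c\<bar>" if z: "z \<in> Oct" for z
  proof -
    obtain x y where z_eq: "z = (x, y)" by (cases z)
    with z have xy: "0 \<le> x" "x \<le> 1" "0 \<le> y" "y \<le> 1"
      by (auto simp: Oct_def)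
    have "\<bar>a * x\<^sup>2\<bar> \<le> \<bar>a\<bar>" "\<bar>b * (x * y)\<bar> \<le> \<bar>b\<bar>" "\<bar>c * y\<^sup>2\<bar> \<le> \<bar>c\<bar>"
      using xy by (auto simp: abs_mult power_le_one mult_le_one intro!: mult_left_le)
    then show ?thesis unfolding p z_eq qform.simps mult.assoc by linarith
  qed
  then show ?thesis by (intro bdd_aboveI2)
qed

lemma abs_qform_le_oct_norm: "z \<in> Oct \<Longrightarrow> \<bar>qform p z\<bar> \<le> oct_norm p"
  unfolding oct_norm_def by (rule cSUP_upper[OF _ bdd_above_qform])

lemma oct_norm_le: "(\<And>z. z \<in> Oct \<Longrightarrow> \<bar>qform p z\<bar> \<le> M) \<Longrightarrow> oct_norm p \<le> M"
  unfolding oct_norm_def using vertices_in_Oct by (intro cSUP_least) auto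

text \<open>One inequality is enough for homogeneity: \<open>k = b\<close> and
  \<open>k = 1 / b\<close> give the two directions of \<open>oct_norm_scale\<close>.\<close>

lemma oct_norm_scale_le: "oct_norm (k * a, k * b, k * c) \<le> \<bar>k\<bar> * oct_norm (a, b, c)"
proof (rule oct_norm_le)
  fix z assume z: "z \<in> Oct"
  have "qform (k * a, k * b, k * c) z = k * qform (a, b, c) z"
    by (cases z) (simp add: algebra_simps)
  then show "\<bar>qform (k * a, k * b, k * c) z\<bar> \<le> \<bar>k\<bar> * oct_norm (a, b, c)"
    using abs_qform_le_oct_norm[OF z] by (simp add: abs_mult mult_left_mono)
qed

lemma oct_norm_scale:
  assumes "b \<noteq> 0"
  shows "oct_norm (a, b, c) = \<bar>b\<bar> * nu (a / b) (c / b)"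
proof (rule antisym)
  show "oct_norm (a, b, c) \<le> \<bar>b\<bar> * nu (a / b) (c / b)"
    using oct_norm_scale_le[of b "a / b" 1 "c / b"] assms by (simp add: nu_def)
  have "nu (a / b) (c / b) \<le> \<bar>1 / b\<bar> * oct_norm (a, b, c)"
    using oct_norm_scale_le[of "1 / b" a b c] assms by (simp add: nu_def)
  then show "\<bar>b\<bar> * nu (a / b) (c / b) \<le> oct_norm (a, b, c)"
    using assms by (simp add: field_simps)
qed

text \<open>Reflection in the diagonal \<open>x = y\<close> preserves the octagon, so results for
  \<open>I1\<close> transfer to \<open>I3\<close>.\<close>

lemma oct_norm_swap: "oct_norm (c, b, a) = oct_norm (a, b, c)"
proof -
  have "oct_norm (c, b, a) \<le> oct_norm (a, b, c)" for a c
  proof (rule oct_norm_le)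
    fix z assume "z \<in> Oct"
    moreover obtain x y where "z = (x, y)" by (cases z)
    ultimately have "(y, x) \<in> Oct" "qform (c, b, a) z = qform (a, b, c) (y, x)"
      by (auto simp: Oct_def algebra_simps)
    then show "\<bar>qform (c, b, a) z\<bar> \<le> oct_norm (a, b, c)"
      using abs_qform_le_oct_norm by metis
  qed
  then show ?thesis by (simp add: antisym)
qed

lemma nu_commute: "nu v u = nu u v"
  by (simp add: nu_def oct_norm_swap)

section \<open>Quadratics on the axis-parallel edges\<close>

lemma abs_convex_combination_le:
  fixes p q s M :: real
  assumes "0 \<le> s" "s \<le> 1" "\<bar>p\<bar> \<le> M" "\<bar>q\<bar> \<le> M"
  shows "\<bar>(1 - s) * p + s * q\<bar> \<le> M"
proof -
  have "\<bar>(1 - s) * p + s * q\<bar> \<le> (1 - s) * \<bar>p\<bar> + s * \<bar>q\<bar>"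
    using assms abs_triangle_ineq[of "(1 - s) * p" "s * q"] by (simp add: abs_mult)
  also have "\<dots> \<le> M"
    using assms by (intro convex_bound_le) auto
  finally show ?thesis .
qed

text \<open>For \<open>u < - eta\<close> the parabola is concave with apex
  \<open>- 1 / (2 * u)\<close> inside the interval: the apex value bounds it above, the chord over
  the interval below. Otherwise it is nondecreasing there and its end values bound it.\<close>

lemma edge_bound:
  assumes x: "0 \<le> x" "x \<le> tau"
    and v: "\<bar>v\<bar> \<le> M" and p: "\<bar>tau\<^sup>2 * u + tau + v\<bar> \<le> M"
    and crit: "u < - eta \<Longrightarrow> v - 1 / (4 * u) \<le> M"
  shows "\<bar>u * x\<^sup>2 + x + v\<bar> \<le> M"
proof (cases "u < - eta")
  case True
  note tau = tau_bounds
  have u: "u < 0" using True tau by (simp add: eta_eq)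
  have "u * x\<^sup>2 + x + 1 / (4 * u) = u * (x + 1 / (2 * u))\<^sup>2"
    using u by (simp add: field_simps power2_eq_square)
  also have "\<dots> \<le> 0"
    using u by (simp add: mult_nonpos_nonneg)
  finally have upper: "u * x\<^sup>2 + x + v \<le> M" using crit[OF True] by simp
  have "\<bar>(1 - x / tau) * v + x / tau * (tau\<^sup>2 * u + tau + v)\<bar> \<le> M"
    using x tau v p by (intro abs_convex_combination_le) auto
  moreover have "(1 - x / tau) * v + x / tau * (tau\<^sup>2 * u + tau + v) = x * u * tau + x + v"
    using tau by (simp add: field_simps power2_eq_square)
  moreover have "x * u * tau \<le> u * x\<^sup>2"
  proof -
    have "0 \<le> x * (tau - x) * (- u)" using x u by (intro mult_nonneg_nonneg) auto
    then show ?thesis by (simp add: algebra_simps power2_eq_square)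
  qed
  ultimately show ?thesis using upper by (simp add: abs_le_iff)
next
  case False
  have tau: "0 < tau" using tau_bounds by simp
  \<comment> \<open>\<open>1 + u * r\<close> is the slope of a chord between two points with sum
    \<open>r\<close>; it is applied from \<open>0\<close> to \<open>x\<close> and from
    \<open>x\<close> to \<open>tau\<close>.\<close>
  have slope: "0 \<le> 1 + u * r" if r: "0 \<le> r" "r \<le> 2 * tau" for r
  proof -
    have "eta * r \<le> eta * (2 * tau)"
      using r tau by (intro mult_left_mono) (auto simp: eta_def)
    also have "\<dots> = 1" using tau by (simp add: eta_def)
    finally have "eta * r \<le> 1" .
    moreover have "- eta * r \<le> u * r"
      using False r by (intro mult_right_mono) auto
    ultimately show ?thesis by simp
  qed
  have "0 \<le> x * (1 + u * x)" "0 \<le> (tau - x) * (1 + u * (tau + x))"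
    using x tau slope by (auto intro!: mult_nonneg_nonneg)
  then have "0 \<le> u * x\<^sup>2 + x" "u * x\<^sup>2 + x \<le> tau\<^sup>2 * u + tau"
    by (simp_all add: algebra_simps power2_eq_square)
  then show ?thesis using v p by (simp add: abs_le_iff)
qed

section \<open>The slanted edge \<open>x + y = sqrt 2\<close>\<close>

text \<open>Multiplying by \<open>1 + tau\<close> brings the lines bounding \<open>I2\<close> into
  the balanced form \<open>v - u = tau * (1 - u - v)\<close>; the key is
  \<open>(1 + tau) * (1 - tau) = 2 * tau\<close>.\<close>

lemma line_scaled: "(1 + tau) * (delta + tau * r) = tau + (1 - tau) * r"
proof -
  have tt: "tau * tau = 1 - 2 * tau" using tau_sq by (simp add: power2_eq_square)
  have "(1 + tau) * delta = tau"
    by (simp add: delta_def field_simps tt)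
  moreover have "(1 + tau) * tau = 1 - tau"
    by (simp add: algebra_simps tt)
  ultimately show ?thesis by (simp add: distrib_left mult.assoc[symmetric])
qed

text \<open>When \<open>u + v < 1\<close>, the right-hand side says that the stationary point
  \<open>(u - v) / (1 - u - v)\<close> of the slanted edge exceeds \<open>- tau\<close>; exchanging
  \<open>u\<close> and \<open>v\<close> puts it below \<open>tau\<close>.\<close>

lemma below_first_line_iff: "v < delta + tau * u \<longleftrightarrow> v - u < tau * (1 - u - v)"
proof -
  have "(1 + tau) * (delta + tau * u - v) = tau * (1 - u - v) - (v - u)"
    using line_scaled[of u] by (simp add: algebra_simps)
  moreover have "0 < 1 + tau" using tau_bounds by simp
  ultimately show ?thesis
    by (metis diff_gt_0_iff_gt zero_less_mult_pos mult_pos_pos)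
qed

text \<open>The form \<open>(u, 1, v)\<close> at
  \<open>((1 + t) / sqrt 2, (1 - t) / sqrt 2)\<close>. Centring the edge at its midpoint puts the
  vertices at \<open>t = tau\<close> and \<open>t = - tau\<close> and rids the coefficients of
  \<open>sqrt 2\<close>.\<close>

definition diag :: "real \<Rightarrow> real \<Rightarrow> real \<Rightarrow> real" where
  "diag u v t = ((u + v + 1) + 2 * (u - v) * t + (u + v - 1) * t\<^sup>2) / 2"

lemma qform_diag: "qform (u, 1, v) (x, sqrt 2 - x) = diag u v (sqrt 2 * x - 1)"
proof -
  \<comment> \<open>The identity rests on \<open>(sqrt 2)\<^sup>2 = 2\<close>, so the difference is
    exhibited as a multiple of \<open>(sqrt 2)\<^sup>2 - 2\<close>.\<close>
  have "qform (u, 1, v) (x, sqrt 2 - x) - diag u v (sqrt 2 * x - 1)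
      = (v + (x\<^sup>2 * (1 - u - v) / 2)) * ((sqrt 2)\<^sup>2 - 2)"
    by (simp add: diag_def field_simps power2_eq_square)
  then show ?thesis by simp
qed

lemma diag_tau: "diag u v tau = u + tau + tau\<^sup>2 * v"
  and diag_minus_tau: "diag u v (- tau) = tau\<^sup>2 * u + tau + v"
  by (simp_all add: diag_def tau_sq field_simps)

text \<open>Completing the square in \<open>t\<close>: the parabola is concave and the bound is its
  global maximum.\<close>

lemma diag_le_Psi2:
  assumes "u + v < 1"
  shows "diag u v t \<le> (1 - 4 * u * v) / (2 * (1 - u - v))"
proof -
  have "2 * (1 - u - v) * diag u v t = 1 - 4 * u * v - ((1 - u - v) * t - (u - v))\<^sup>2"
    by (simp add: diag_def field_simps power2_eq_square)
  also have "\<dots> \<le> 1 - 4 * u * v" by simp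
  finally show ?thesis using assms by (simp add: field_simps)
qed

lemma diag_critical:
  assumes "u + v < 1"
  shows "diag u v ((u - v) / (1 - u - v)) = (1 - 4 * u * v) / (2 * (1 - u - v))"
proof -
  define t where "t = (u - v) / (1 - u - v)"
  have t: "(1 - u - v) * t = u - v" using assms by (simp add: t_def)
  have "2 * (1 - u - v) * diag u v t = 1 - 4 * u * v - ((1 - u - v) * t - (u - v))\<^sup>2"
    by (simp add: diag_def field_simps power2_eq_square)
  then have "2 * (1 - u - v) * diag u v t = 1 - 4 * u * v" by (simp add: t)
  then show ?thesis unfolding t_def[symmetric] using assms by (simp add: field_simps)
qed

text \<open>The sign of \<open>s = u + v - 1\<close> separates concave from convex, and
  \<open>\<bar>u - v\<bar> < tau * \<bar>s\<bar>\<close> says that the stationary point is inside.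
  Inside and concave: the maximum bounds above, the chord below. Inside and convex: the chord bounds
  above and the values are nonnegative. Otherwise \<open>diag\<close> is monotone and the vertices
  decide.\<close>

lemma diag_bound:
  assumes t: "- tau \<le> t" "t \<le> tau"
    and p: "\<bar>tau\<^sup>2 * u + tau + v\<bar> \<le> M" and q: "\<bar>u + tau + tau\<^sup>2 * v\<bar> \<le> M"
    and crit: "v < delta + tau * u \<Longrightarrow> u < delta + tau * v \<Longrightarrow>
      (1 - 4 * u * v) / (2 * (1 - u - v)) \<le> M"
  shows "\<bar>diag u v t\<bar> \<le> M"
proof -
  have tau: "0 < tau" using tau_bounds by simp
  define w where "w = (t + tau) / (2 * tau)"
  have chord: "\<bar>(1 - w) * diag u v (- tau) + w * diag u v tau\<bar> \<le> M"
    using t tau p q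
    by (intro abs_convex_combination_le) (auto simp: w_def field_simps diag_tau diag_minus_tau)
  have t_eq: "t = 2 * tau * w - tau" using tau by (simp add: w_def field_simps)
  \<comment> \<open>The gap between a quadratic and its chord is, up to sign, the leading
    coefficient times the distances to both ends; the sign of \<open>u + v - 1\<close> tells which
    lies higher.\<close>
  have diag_chord: "diag u v t = (1 - w) * diag u v (- tau) + w * diag u v tau
      - (u + v - 1) * ((tau - t) * (tau + t)) / 2"
    unfolding t_eq by (simp add: diag_def field_simps power2_eq_square)
  have tt: "0 \<le> (tau - t) * (tau + t)" using t by simp
  have ends: "\<bar>diag u v tau\<bar> \<le> M" "\<bar>diag u v (- tau)\<bar> \<le> M"
    using p q by (simp_all add: diag_tau diag_minus_tau)
  define s where "s = u + v - 1"
  have diff1: "diag u v tau - diag u v t = (tau - t) * (2 * (u - v) + s * (t + tau)) / 2"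
    and diff2: "diag u v t - diag u v (- tau) = (t + tau) * (2 * (u - v) - s * (tau - t)) / 2"
    by (simp_all add: diag_def s_def field_simps power2_eq_square)
  have slope: "\<bar>s * (t + tau)\<bar> \<le> 2 * (tau * \<bar>s\<bar>)" "\<bar>s * (tau - t)\<bar> \<le> 2 * (tau * \<bar>s\<bar>)"
  proof -
    have "\<bar>s * r\<bar> \<le> 2 * (tau * \<bar>s\<bar>)" if "\<bar>r\<bar> \<le> 2 * tau" for r
      using mult_left_mono[OF that, of "\<bar>s\<bar>"] by (simp add: abs_mult ac_simps)
    then show "\<bar>s * (t + tau)\<bar> \<le> 2 * (tau * \<bar>s\<bar>)" "\<bar>s * (tau - t)\<bar> \<le> 2 * (tau * \<bar>s\<bar>)"
      using t by simp_all
  qed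
  have dominate: "\<bar>A\<bar> \<le> 2 * d" if "K \<le> d" "\<bar>A\<bar> \<le> 2 * K" for A d K :: real
    using that by linarith
  consider "\<bar>u - v\<bar> < tau * \<bar>s\<bar>" "s < 0" | "\<bar>u - v\<bar> < tau * \<bar>s\<bar>" "s > 0"
    | "tau * \<bar>s\<bar> \<le> u - v" | "tau * \<bar>s\<bar> \<le> v - u"
  proof (cases "\<bar>u - v\<bar> < tau * \<bar>s\<bar>")
    case True
    then have "s \<noteq> 0" by auto
    with True that(1,2) show ?thesis by linarith
  next
    case False
    then have "tau * \<bar>s\<bar> \<le> u - v \<or> tau * \<bar>s\<bar> \<le> v - u" by linarith
    with that(3,4) show ?thesis by blast
  qed
  then show ?thesis
  proof cases
    case 1
    have 2: "v < delta + tau * u" "u < delta + tau * v"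
      using 1 by (auto simp: below_first_line_iff s_def algebra_simps abs_less_iff)
    have "diag u v t \<le> M"
      using diag_le_Psi2[of u v t] crit[OF 2] 1 by (simp add: s_def)
    moreover have "(u + v - 1) * ((tau - t) * (tau + t)) \<le> 0"
      using 1 tt by (intro mult_nonpos_nonneg) (auto simp: s_def)
    ultimately show ?thesis using chord diag_chord by (simp add: abs_le_iff)
  next
    case 2
    have le: "diag u v t \<le> (1 - w) * diag u v (- tau) + w * diag u v tau"
      using diag_chord tt 2 by (simp add: s_def)
    have "\<bar>t\<bar> \<le> 1" using t tau_bounds by auto
    \<comment> \<open>Because \<open>tau < 1 / 2\<close>, the constant term \<open>s + 2\<close> of
      \<open>2 * diag u v t\<close> outweighs the linear term, which is at most \<open>s\<close> in
      absolute value.\<close>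
    have "\<bar>u - v\<bar> * \<bar>t\<bar> \<le> (s / 2) * 1"
    proof (intro mult_mono)
      have "tau * s \<le> 1 / 2 * s" using tau_bounds 2 by (intro mult_right_mono) auto
      then show "\<bar>u - v\<bar> \<le> s / 2" using 2 by linarith
    qed (use 2 \<open>\<bar>t\<bar> \<le> 1\<close> in auto)
    then have "- s / 2 \<le> (u - v) * t" by (simp add: abs_mult[symmetric] abs_le_iff)
    moreover have "0 \<le> s * t\<^sup>2" using 2 by simp
    moreover have "2 * diag u v t = s + 2 + 2 * ((u - v) * t) + s * t\<^sup>2"
      by (simp add: diag_def s_def)
    ultimately have "0 \<le> diag u v t" using 2 by linarith
    with le chord show ?thesis by simp
  next
    case 3
    have "0 \<le> 2 * (u - v) + s * (t + tau)" "0 \<le> 2 * (u - v) - s * (tau - t)"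
      using dominate[OF 3 slope(1)] dominate[OF 3 slope(2)] by auto
    then have "0 \<le> diag u v tau - diag u v t" "0 \<le> diag u v t - diag u v (- tau)"
      unfolding diff1 diff2 using t by auto
    with ends show ?thesis by (simp add: abs_le_iff)
  next
    case 4
    have "2 * (u - v) + s * (t + tau) \<le> 0" "2 * (u - v) - s * (tau - t) \<le> 0"
      using dominate[OF 4 slope(1)] dominate[OF 4 slope(2)] by auto
    then have "diag u v tau - diag u v t \<le> 0" "diag u v t - diag u v (- tau) \<le> 0"
      unfolding diff1 diff2 using t by (auto intro!: mult_nonneg_nonpos)
    with ends show ?thesis by (simp add: abs_le_iff)
  qed
qed

section \<open>Upper and lower bounds for \<open>nu\<close>\<close>

text \<open>Collects the edge estimates: four vertex values, and three stationary values that are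
  demanded only for parameters placing a maximum strictly inside the edge.\<close>

lemma nu_le:
  assumes "\<bar>u\<bar> \<le> M" "\<bar>v\<bar> \<le> M"
    and "\<bar>tau\<^sup>2 * u + tau + v\<bar> \<le> M" "\<bar>u + tau + tau\<^sup>2 * v\<bar> \<le> M"
    and "u < - eta \<Longrightarrow> v - 1 / (4 * u) \<le> M"
    and "v < - eta \<Longrightarrow> u - 1 / (4 * v) \<le> M"
    and "v < delta + tau * u \<Longrightarrow> u < delta + tau * v \<Longrightarrow>
      (1 - 4 * u * v) / (2 * (1 - u - v)) \<le> M"
  shows "nu u v \<le> M"
  unfolding nu_def
proof (rule oct_norm_le, rule abs_qform_le_if_edges)
  show "\<bar>qform (u, 1, v) (1, y)\<bar> \<le> M" if "0 \<le> y" "y \<le> tau" for y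
    using edge_bound[of y u M v] that assms by (simp add: algebra_simps)
  show "\<bar>qform (u, 1, v) (x, 1)\<bar> \<le> M" if "0 \<le> x" "x \<le> tau" for x
    using edge_bound[of x v M u] that assms by simp
  show "\<bar>qform (u, 1, v) (x, sqrt 2 - x)\<bar> \<le> M" if x: "tau \<le> x" "x \<le> 1" for x
    unfolding qform_diag
  proof (rule diag_bound)
    have "sqrt 2 * tau \<le> sqrt 2 * x" "sqrt 2 * x \<le> sqrt 2 * 1"
      using x by (auto intro: mult_left_mono)
    moreover have "sqrt 2 * tau = 1 - tau"
      using tau_sq by (simp add: sqrt2_eq algebra_simps power2_eq_square)
    ultimately show "- tau \<le> sqrt 2 * x - 1" "sqrt 2 * x - 1 \<le> tau"
      by (simp_all add: sqrt2_eq)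
  qed (use assms in auto)
qed

lemma vertices_le_nu:
  "\<bar>u\<bar> \<le> nu u v" "\<bar>v\<bar> \<le> nu u v"
  "\<bar>tau\<^sup>2 * u + tau + v\<bar> \<le> nu u v" "\<bar>u + tau + tau\<^sup>2 * v\<bar> \<le> nu u v"
  unfolding nu_def using abs_qform_le_oct_norm[of _ "(u, 1, v)"] vertices_in_Oct
  by (force simp: mult.commute)+

lemma diag_le_nu:
  assumes "\<bar>t\<bar> \<le> tau"
  shows "\<bar>diag u v t\<bar> \<le> nu u v"
proof -
  \<comment> \<open>Inverse of the substitution \<open>t = sqrt 2 * x - 1\<close>.\<close>
  define x where "x = (1 + t) / sqrt 2"
  have "sqrt 2 - x = (1 - t) / sqrt 2"
    by (simp add: x_def field_simps)
  then have "(x, sqrt 2 - x) \<in> Oct"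
    using assms tau_bounds by (auto simp: Oct_def x_def field_simps sqrt2_eq)
  moreover have "sqrt 2 * x - 1 = t"
    by (simp add: x_def)
  ultimately show ?thesis
    unfolding nu_def using abs_qform_le_oct_norm qform_diag by metis
qed

section \<open>The formulas on \<open>I1\<close>, \<open>I2\<close> and \<open>I3\<close>\<close>

text \<open>The second inequality of \<open>I1\<close> says that the apex value is at least
  \<open>- u\<close>, and it then dominates every vertex value. The first keeps the apex on the edge
  \<open>y = 1\<close>, so the value is attained.\<close>

lemma nu_I1:
  assumes "(u, v) \<in> I1"
  shows "nu u v = v - 1 / (4 * u)"
proof (rule antisym)
  note tau = tau_bounds
  from assms have u: "u \<le> - eta" and v: "- u + 1 / (4 * u) \<le> v" by (auto simp: I1_def)
  have u1: "u \<le> - 1" using u tau by (simp add: eta_eq)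
  have inv: "- (1 / 4) \<le> 1 / (4 * u)" "1 / (4 * u) \<le> 0" using u1 by (auto simp: field_simps)
  have v0: "0 \<le> v" using v inv u1 by linarith
  have "\<bar>tau\<^sup>2 * u + tau + v\<bar> \<le> v - 1 / (4 * u)"
  proof -
    have "tau\<^sup>2 * u + tau + 1 / (4 * u) = u * (tau + 1 / (2 * u))\<^sup>2"
      using u1 by (simp add: field_simps power2_eq_square)
    also have "\<dots> \<le> 0" using u1 by (simp add: mult_nonpos_nonneg)
    finally have "tau\<^sup>2 * u + tau + v \<le> v - 1 / (4 * u)" by simp
    moreover have "tau\<^sup>2 * (- u) \<le> 1 * (- u)"
      using u1 tau by (intro mult_right_mono) (auto simp: power_le_one)
    ultimately show ?thesis using v v0 tau by linarith
  qed
  moreover have "\<bar>u + tau + tau\<^sup>2 * v\<bar> \<le> v - 1 / (4 * u)"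
  proof -
    have "tau\<^sup>2 * v \<le> 1 * v" using v0 tau by (intro mult_right_mono) (auto simp: power_le_one)
    moreover have "0 \<le> tau\<^sup>2 * v" using v0 by simp
    ultimately show ?thesis using v v0 u1 inv tau by linarith
  qed
  \<comment> \<open>The right side is negative while \<open>v\<close> is nonnegative, so the
    slanted-edge premise of \<open>nu_le\<close> becomes vacuous.\<close>
  moreover have "\<not> v < delta + tau * u"
  proof -
    have "tau * u \<le> tau * (- eta)" using u tau by (intro mult_left_mono) auto
    also have "\<dots> = - 1 / 2" using tau by (simp add: eta_def)
    finally show ?thesis using v0 tau unfolding delta_eq by linarith
  qed
  ultimately show "nu u v \<le> v - 1 / (4 * u)"
    using u1 v0 v inv tau by (intro nu_le) (auto simp: eta_eq)
next
  note tau = tau_bounds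
  from assms have u: "u \<le> - eta" by (auto simp: I1_def)
  define x where "x = - 1 / (2 * u)"
  have neg: "u < 0" using u tau by (simp add: eta_eq)
  have "tau * u \<le> tau * (- eta)" using u tau by (intro mult_left_mono) auto
  also have "\<dots> = - 1 / 2" using tau by (simp add: eta_def)
  finally have "x \<le> tau" using neg by (simp add: x_def field_simps)
  moreover have "0 \<le> x" using neg by (simp add: x_def)
  ultimately have "(x, 1) \<in> Oct" using tau by (auto simp: Oct_def sqrt2_eq)
  moreover have "qform (u, 1, v) (x, 1) = v - 1 / (4 * u)"
    using neg by (simp add: x_def field_simps power2_eq_square)
  ultimately show "v - 1 / (4 * u) \<le> nu u v"
    unfolding nu_def using abs_qform_le_oct_norm by (metis abs_le_D1)
qed

lemma nu_I3:
  assumes "(u, v) \<in> I3"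
  shows "nu u v = u - 1 / (4 * v)"
  using assms nu_I1[of v u] nu_commute[of u v] by (simp add: I1_def I3_def)

text \<open>Keeps \<open>v\<close>, and by symmetry \<open>u\<close>, above \<open>- eta\<close>,
  which excludes interior maxima on the axis-parallel edges over \<open>I2\<close>. If
  \<open>v < - 1\<close>, the line forces \<open>u < 0\<close>, and then
  \<open>2 * v\<^sup>2\<close>, \<open>6 * u * v\<close> and \<open>- 2 * v - 1\<close> add up to a
  positive number.\<close>

lemma minus_one_le_if_I2:
  fixes u v :: real
  assumes "u \<le> delta + tau * v" "2 * v\<^sup>2 + 6 * u * v - 2 * v - 1 \<le> 0"
  shows "- 1 \<le> v"
proof (rule ccontr)
  assume "\<not> - 1 \<le> v"
  then have v: "v < - 1" by simp
  then have "tau * v \<le> tau * (- 1)" using tau_bounds by (intro mult_left_mono) auto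
  with assms have "u < 0" using tau_bounds unfolding delta_eq by linarith
  with v have "0 \<le> 6 * u * v" by (simp add: mult_nonpos_nonpos)
  then show False using assms v zero_le_power2[of v] by linarith
qed

text \<open>For \<open>u + v < 1\<close>, the linear inequalities place the stationary point in
  \<open>[- tau, tau]\<close>, so its value is attained; the quadratic ones, after division, say
  that this value is at least \<open>- u\<close> and \<open>- v\<close>.\<close>

lemma nu_I2:
  assumes "(u, v) \<in> I2"
  shows "nu u v = Psi2 u v"
proof -
  note tau = tau_bounds
  from assms have uv: "v \<le> delta + tau * u" "u \<le> delta + tau * v"
    and P: "2 * u\<^sup>2 + 6 * u * v - 2 * u - 1 \<le> 0" "2 * v\<^sup>2 + 6 * u * v - 2 * v - 1 \<le> 0"
    by (auto simp: I2_def)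
  have expand: "(1 - tau) * (u + v) = u + v - (tau * u + tau * v)" by (simp add: algebra_simps)
  \<comment> \<open>Sum of the two linear constraints, as
    \<open>2 * delta = 1 - tau\<close>.\<close>
  have "(1 - tau) * (u + v) \<le> (1 - tau) * 1"
    unfolding expand mult_1_right using uv unfolding delta_eq by linarith
  then have s1: "u + v \<le> 1" using tau by (simp del: mult_1_right)
  show ?thesis
  proof (cases "u + v = 1")
    case True
    then have "v = 1 - u" by simp
    with uv have "(1 + tau) * (1 / 2) \<le> (1 + tau) * u" "(1 + tau) * u \<le> (1 + tau) * (1 / 2)"
      by (simp_all add: delta_eq algebra_simps)
    then have "u = 1/2" using tau by (simp add: mult_le_cancel_left)
    then have eq: "u = 1/2" "v = 1/2" using True by auto
    \<comment> \<open>Here the form is \<open>(x + y)\<^sup>2 / 2\<close>, equal to 1 on the whole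
      slanted edge, in agreement with the special value of \<open>Psi2\<close>.\<close>
    have "nu (1/2) (1/2) \<le> 1"
      using tau by (intro nu_le) (auto simp: tau_sq eta_eq delta_eq abs_le_iff diff_divide_distrib)
    moreover have "1 \<le> nu (1/2) (1/2)"
      using diag_le_nu[of 0 "1/2" "1/2"] tau by (simp add: diag_def)
    ultimately show ?thesis unfolding eq by (simp add: Psi2_def)
  next
    case False
    with s1 have s: "u + v < 1" by simp
    define m where "m = (1 - 4 * u * v) / (2 * (1 - u - v))"
    have Psi: "Psi2 u v = m" using s by (auto simp: Psi2_def m_def)
    have le_mI: "r \<le> m" if "r * (2 * (1 - u - v)) \<le> 1 - 4 * u * v" for r
      using that s by (simp add: m_def field_simps)
    have "- u \<le> m" "- v \<le> m"
      using P by (auto intro!: le_mI simp: algebra_simps power2_eq_square)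
    \<comment> \<open>After clearing the denominator the gaps are the squares of
      \<open>1 - 2 * u\<close> and \<open>1 - 2 * v\<close>.\<close>
    moreover have "2 * u \<le> m" "2 * v \<le> m"
      using zero_le_power2[of "1 - 2 * u"] zero_le_power2[of "1 - 2 * v"]
      by (auto intro!: le_mI simp: algebra_simps power2_eq_square)
    ultimately have abs_le: "\<bar>u\<bar> \<le> m" "\<bar>v\<bar> \<le> m" by (auto simp: abs_le_iff)
    have one: "- 1 \<le> v" "- 1 \<le> u"
      using uv P minus_one_le_if_I2[of u v] minus_one_le_if_I2[of v u] by (simp_all add: ac_simps)
    \<comment> \<open>Hence the values at \<open>(tau, 1)\<close> and \<open>(1, tau)\<close> are at
      least \<open>v\<close> and \<open>u\<close>, so at least \<open>- m\<close>.\<close>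
    have low: "0 \<le> tau + tau\<^sup>2 * r" if "- 1 \<le> r" for r
    proof -
      have "tau\<^sup>2 * (- 1) \<le> tau\<^sup>2 * r" using that by (intro mult_left_mono) auto
      then show ?thesis using tau by (simp add: tau_sq)
    qed
    have "diag u v tau \<le> m" "diag u v (- tau) \<le> m"
      using diag_le_Psi2[OF s] by (simp_all add: m_def)
    then have "\<bar>tau\<^sup>2 * u + tau + v\<bar> \<le> m" "\<bar>u + tau + tau\<^sup>2 * v\<bar> \<le> m"
      using low[OF one(1)] low[OF one(2)] abs_le
      by (simp_all add: diag_tau diag_minus_tau abs_le_iff)
    then have "nu u v \<le> m"
      using abs_le one tau by (intro nu_le) (auto simp: eta_eq m_def)
    moreover have "m \<le> nu u v"
    proof -
      have "v - u \<le> tau * (1 - u - v)" "u - v \<le> tau * (1 - u - v)"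
      proof -
        have "(1 + tau) * v \<le> (1 + tau) * (delta + tau * u)"
          "(1 + tau) * u \<le> (1 + tau) * (delta + tau * v)"
          using uv tau by (auto intro: mult_left_mono)
        then show "v - u \<le> tau * (1 - u - v)" "u - v \<le> tau * (1 - u - v)"
          unfolding line_scaled by (simp_all add: algebra_simps)
      qed
      then have "\<bar>(u - v) / (1 - u - v)\<bar> \<le> tau"
        using s by (simp add: abs_le_iff field_simps)
      then have "\<bar>m\<bar> \<le> nu u v"
        using diag_le_nu diag_critical[OF s] m_def by metis
      then show ?thesis by simp
    qed
    ultimately show ?thesis by (simp add: Psi)
  qed
qed

section \<open>Interiors of the regions and the formula outside them\<close>

text \<open>Multiplying by \<open>4 * u < 0\<close> reverses the inequality and replaces the
  quotient by a polynomial, so openness follows from continuity.\<close>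

lemma interior_I1:
  assumes "u < - eta" "- u + 1 / (4 * u) < v"
  shows "(u, v) \<in> interior I1"
proof (rule interiorI)
  let ?S = "{p :: real \<times> real. fst p < - eta \<and> 4 * fst p * snd p < 1 - 4 * (fst p)\<^sup>2}"
  have neg: "r < 0" if "r < - eta" for r using that tau_bounds by (simp add: eta_eq)
  have iff: "4 * r * s < 1 - 4 * r\<^sup>2 \<longleftrightarrow> - r + 1 / (4 * r) < s" if "r < 0" for r s :: real
    using that by (simp add: field_simps power2_eq_square)
  show "open ?S" by (intro open_Collect_conj open_Collect_less continuous_intros)
  show "(u, v) \<in> ?S" using assms iff neg by simp
  show "?S \<subseteq> I1" using iff neg by (force simp: I1_def)
qed

lemma interior_I3:
  assumes "v < - eta" "- v + 1 / (4 * v) < u"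
  shows "(u, v) \<in> interior I3"
proof (rule interiorI)
  let ?S = "{p :: real \<times> real. snd p < - eta \<and> 4 * snd p * fst p < 1 - 4 * (snd p)\<^sup>2}"
  have neg: "r < 0" if "r < - eta" for r using that tau_bounds by (simp add: eta_eq)
  have iff: "4 * r * s < 1 - 4 * r\<^sup>2 \<longleftrightarrow> - r + 1 / (4 * r) < s" if "r < 0" for r s :: real
    using that by (simp add: field_simps power2_eq_square)
  show "open ?S" by (intro open_Collect_conj open_Collect_less continuous_intros)
  show "(u, v) \<in> ?S" using assms iff neg by simp
  show "?S \<subseteq> I3" using iff neg by (force simp: I3_def)
qed

lemma interior_I2:
  assumes "v < delta + tau * u" "u < delta + tau * v"
    and "2 * u\<^sup>2 + 6 * u * v - 2 * u - 1 < 0" "2 * v\<^sup>2 + 6 * u * v - 2 * v - 1 < 0"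
  shows "(u, v) \<in> interior I2"
proof (rule interiorI)
  let ?S = "{p :: real \<times> real. snd p < delta + tau * fst p \<and> fst p < delta + tau * snd p \<and>
    2 * (fst p)\<^sup>2 + 6 * fst p * snd p - 2 * fst p - 1 < 0 \<and>
    2 * (snd p)\<^sup>2 + 6 * fst p * snd p - 2 * snd p - 1 < 0}"
  show "open ?S" by (intro open_Collect_conj open_Collect_less continuous_intros)
  show "(u, v) \<in> ?S" using assms by simp
  show "?S \<subseteq> I2" by (auto simp: I2_def)
qed

text \<open>Off the interiors, a maximum inside an edge forces another strict inequality of the
  corresponding region to fail. That failure says that the stationary value is at most
  \<open>- u\<close> or \<open>- v\<close>, so the vertices decide.\<close>

lemma nu_E0:
  assumes "(u, v) \<in> E0"
  shows "nu u v = max (Phi1 u v) (Phi3 u v)"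
proof (rule antisym)
  let ?M = "max (Phi1 u v) (Phi3 u v)"
  have vert: "\<bar>u\<bar> \<le> ?M" "\<bar>v\<bar> \<le> ?M" "\<bar>tau\<^sup>2 * u + tau + v\<bar> \<le> ?M" "\<bar>u + tau + tau\<^sup>2 * v\<bar> \<le> ?M"
    by (simp_all add: Phi1_def Phi3_def le_max_iff_disj)
  have notin: "(u, v) \<notin> interior I1" "(u, v) \<notin> interior I2" "(u, v) \<notin> interior I3"
    using assms by (auto simp: E0_def)
  show "nu u v \<le> ?M"
  proof (rule nu_le[OF vert])
    show "v - 1 / (4 * u) \<le> ?M" if "u < - eta"
      using interior_I1[OF that] notin vert by force
    show "u - 1 / (4 * v) \<le> ?M" if "v < - eta"
      using interior_I3[OF that] notin vert by force
  next
    assume uv: "v < delta + tau * u" "u < delta + tau * v"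
    have expand: "(1 - tau) * (u + v) = u + v - (tau * u + tau * v)" by (simp add: algebra_simps)
    have "(1 - tau) * (u + v) < (1 - tau) * 1"
      unfolding expand mult_1_right using uv unfolding delta_eq by linarith
    then have s: "u + v < 1" using tau_bounds by (simp del: mult_1_right)
    from interior_I2[OF uv] notin
    consider "0 \<le> 2 * u\<^sup>2 + 6 * u * v - 2 * u - 1" | "0 \<le> 2 * v\<^sup>2 + 6 * u * v - 2 * v - 1"
      by force
    then have "(1 - 4 * u * v) / (2 * (1 - u - v)) \<le> - u \<or>
        (1 - 4 * u * v) / (2 * (1 - u - v)) \<le> - v"
      using s by cases (simp_all add: field_simps power2_eq_square)
    then show "(1 - 4 * u * v) / (2 * (1 - u - v)) \<le> ?M"
      using vert by linarith
  qed
  show "?M \<le> nu u v"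
    using vertices_le_nu by (simp add: Phi1_def Phi3_def)
qed

section \<open>Forms without a mixed term\<close>

text \<open>On an axis-parallel edge the form is affine in the square of the free coordinate, so the
  ends decide. On the slanted edge, coefficients of equal sign are treated by convexity of the
  square, and those of opposite sign by cancellation.\<close>

lemma oct_norm_no_mixed_term:
  "oct_norm (a, 0, c) = Max {\<bar>a\<bar>, \<bar>c\<bar>, \<bar>tau\<^sup>2 * a + c\<bar>, \<bar>a + tau\<^sup>2 * c\<bar>}" (is "_ = ?M")
proof -
  define M where "M = ?M"
  note tau = tau_bounds
  have vert: "\<bar>a\<bar> \<le> M" "\<bar>c\<bar> \<le> M" "\<bar>tau\<^sup>2 * a + c\<bar> \<le> M" "\<bar>a + tau\<^sup>2 * c\<bar> \<le> M"
    unfolding M_def by (rule Max_ge; simp)+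
  have square: "0 \<le> x\<^sup>2 / tau\<^sup>2 \<and> x\<^sup>2 / tau\<^sup>2 \<le> 1" if "0 \<le> x" "x \<le> tau" for x
    using that tau by (simp add: power_mono)
  have edge: "\<bar>p * x\<^sup>2 + q\<bar> \<le> M"
    if "\<bar>q\<bar> \<le> M" "\<bar>tau\<^sup>2 * p + q\<bar> \<le> M" "0 \<le> x" "x \<le> tau" for p q x
  proof -
    have "\<bar>(1 - x\<^sup>2 / tau\<^sup>2) * q + x\<^sup>2 / tau\<^sup>2 * (tau\<^sup>2 * p + q)\<bar> \<le> M"
      using that square by (intro abs_convex_combination_le) auto
    moreover have "(1 - x\<^sup>2 / tau\<^sup>2) * q + x\<^sup>2 / tau\<^sup>2 * (tau\<^sup>2 * p + q) = p * x\<^sup>2 + q"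
      using tau by (simp add: field_simps)
    ultimately show ?thesis by simp
  qed
  have "oct_norm (a, 0, c) \<le> M"
  proof (rule oct_norm_le, rule abs_qform_le_if_edges)
    show "\<bar>qform (a, 0, c) (1, y)\<bar> \<le> M" if "0 \<le> y" "y \<le> tau" for y
      using edge[of a c y] that vert by (simp add: add.commute)
    show "\<bar>qform (a, 0, c) (x, 1)\<bar> \<le> M" if "0 \<le> x" "x \<le> tau" for x
      using edge[of c a x] that vert by simp
  next
    fix x assume x: "tau \<le> x" "x \<le> 1"
    define y where "y = sqrt 2 - x"
    have y: "tau \<le> y" "y \<le> 1" using x by (auto simp: y_def sqrt2_eq)
    have "\<bar>a * x\<^sup>2 + c * y\<^sup>2\<bar> \<le> M"
    proof (cases "0 \<le> a * c")
      case True
      \<comment> \<open>Affine parameter from \<open>(tau, 1)\<close> at \<open>w = 0\<close> to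
        \<open>(1, tau)\<close> at \<open>w = 1\<close>.\<close>
      define w where "w = (x - tau) / (1 - tau)"
      have "\<bar>(1 - w) * (tau\<^sup>2 * a + c) + w * (a + tau\<^sup>2 * c)\<bar> \<le> M"
        using x tau vert by (intro abs_convex_combination_le) (auto simp: w_def)
      moreover have "\<bar>a * x\<^sup>2 + c * y\<^sup>2\<bar> \<le> \<bar>(1 - w) * (tau\<^sup>2 * a + c) + w * (a + tau\<^sup>2 * c)\<bar>"
      proof -
        have xw: "x = tau + w * (1 - tau)" using tau by (simp add: w_def)
        have w: "0 \<le> w" "w \<le> 1" using x tau by (auto simp: w_def)
        have yw: "y = 1 - w * (1 - tau)" by (simp add: y_def xw sqrt2_eq)
        have cx: "x\<^sup>2 \<le> (1 - w) * tau\<^sup>2 + w"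
        proof -
          have "(1 - w) * tau\<^sup>2 + w - x\<^sup>2 = w * (1 - w) * (1 - tau)\<^sup>2"
            by (simp add: xw algebra_simps power2_eq_square)
          then show ?thesis using w by (metis diff_ge_0_iff_ge mult_nonneg_nonneg zero_le_power2)
        qed
        have cy: "y\<^sup>2 \<le> (1 - w) + w * tau\<^sup>2"
        proof -
          have "(1 - w) + w * tau\<^sup>2 - y\<^sup>2 = w * (1 - w) * (1 - tau)\<^sup>2"
            by (simp add: yw algebra_simps power2_eq_square)
          then show ?thesis using w by (metis diff_ge_0_iff_ge mult_nonneg_nonneg zero_le_power2)
        qed
        \<comment> \<open>Equal signs let the absolute value split, so the bounds on both squares
          can be weighted by \<open>\<bar>a\<bar>\<close> and \<open>\<bar>c\<bar>\<close>.\<close>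
        have same_sign: "\<bar>a * r + c * s\<bar> = \<bar>a\<bar> * r + \<bar>c\<bar> * s" if "0 \<le> r" "0 \<le> s" for r s
        proof (cases "0 \<le> a \<and> 0 \<le> c")
          case False
          with True have "a \<le> 0" "c \<le> 0" by (auto simp: zero_le_mult_iff)
          with that have "a * r \<le> 0" "c * s \<le> 0" by (auto intro: mult_nonpos_nonneg)
          with \<open>a \<le> 0\<close> \<open>c \<le> 0\<close> show ?thesis by simp
        qed (use that in simp)
        have "\<bar>a * x\<^sup>2 + c * y\<^sup>2\<bar> = \<bar>a\<bar> * x\<^sup>2 + \<bar>c\<bar> * y\<^sup>2" by (simp add: same_sign)
        also have "\<dots> \<le> \<bar>a\<bar> * ((1 - w) * tau\<^sup>2 + w) + \<bar>c\<bar> * ((1 - w) + w * tau\<^sup>2)"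
          using cx cy by (intro add_mono mult_left_mono) auto
        also have "\<dots> = \<bar>a * ((1 - w) * tau\<^sup>2 + w) + c * ((1 - w) + w * tau\<^sup>2)\<bar>"
          using w by (simp add: same_sign)
        finally show ?thesis by (simp add: algebra_simps)
      qed
      ultimately show ?thesis by simp
    next
      case False
      then consider "0 \<le> a" "c \<le> 0" | "a \<le> 0" "0 \<le> c"
        by (auto simp: zero_le_mult_iff)
      then have "0 \<le> a * x\<^sup>2 \<and> c * y\<^sup>2 \<le> 0 \<or> a * x\<^sup>2 \<le> 0 \<and> 0 \<le> c * y\<^sup>2"
        by cases (simp_all add: mult_nonpos_nonneg)
      then have "\<bar>a * x\<^sup>2 + c * y\<^sup>2\<bar> \<le> max \<bar>a * x\<^sup>2\<bar> \<bar>c * y\<^sup>2\<bar>"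
        by linarith
      also have "\<dots> \<le> max \<bar>a\<bar> \<bar>c\<bar>"
        using x y tau by (intro max.mono) (auto simp: abs_mult power_le_one intro!: mult_left_le)
      finally show ?thesis using vert by simp
    qed
    then show "\<bar>qform (a, 0, c) (x, sqrt 2 - x)\<bar> \<le> M" by (simp add: y_def)
  qed
  moreover have "M \<le> oct_norm (a, 0, c)"
    using abs_qform_le_oct_norm[OF vertices_in_Oct(1), of "(a, 0, c)"]
      abs_qform_le_oct_norm[OF vertices_in_Oct(2), of "(a, 0, c)"]
      abs_qform_le_oct_norm[OF vertices_in_Oct(3), of "(a, 0, c)"]
      abs_qform_le_oct_norm[OF vertices_in_Oct(4), of "(a, 0, c)"]
    by (simp add: M_def mult.commute)
  ultimately show ?thesis by (simp only: M_def antisym)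
qed

section \<open>Assembly of the formulas and covering of the plane\<close>

theorem theorem2p2:
  shows "(\<forall>u v :: real.
            ((u, v) \<in> I1 \<longrightarrow> nu u v = v - 1 / (4 * u)) \<and>
            ((u, v) \<in> I2 \<longrightarrow> nu u v = Psi2 u v) \<and>
            ((u, v) \<in> I3 \<longrightarrow> nu u v = u - 1 / (4 * v)) \<and>
            ((u, v) \<in> E1 \<longrightarrow> nu u v = Phi1 u v) \<and>
            ((u, v) \<in> E3 \<longrightarrow> nu u v = Phi3 u v)) \<and>
         I1 \<union> I2 \<union> I3 \<union> E1 \<union> E3 = UNIV \<and>
         (\<forall>a b c :: real. b \<noteq> 0 \<longrightarrow> oct_norm (a, b, c) = \<bar>b\<bar> * nu (a / b) (c / b)) \<and>
         (\<forall>a c :: real. oct_norm (a, 0, c) =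
            Max {\<bar>a\<bar>, \<bar>c\<bar>, \<bar>tau\<^sup>2 * a + c\<bar>, \<bar>a + tau\<^sup>2 * c\<bar>})"
proof (intro conjI allI impI)
  fix u v :: real
  show "nu u v = Phi1 u v" if "(u, v) \<in> E1"
    using that nu_E0[of u v] by (auto simp: E1_def)
  show "nu u v = Phi3 u v" if "(u, v) \<in> E3"
    using that nu_E0[of u v] by (auto simp: E3_def)
next
  \<comment> \<open>Comparing \<open>Phi1\<close> with \<open>Phi3\<close> splits \<open>E0\<close>;
    its complement consists of interiors, which lie in the regions themselves.\<close>
  have "E0 = E1 \<union> E3" by (auto simp: E1_def E3_def)
  then show "I1 \<union> I2 \<union> I3 \<union> E1 \<union> E3 = UNIV"
    using interior_subset unfolding E0_def by blast
qed (simp_all add: nu_I1 nu_I2 nu_I3 oct_norm_scale oct_norm_no_mixed_term del: Max_insert)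

end
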